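(* Let $(p_m)_{m\ge 0}$ and $(u_m)_{m\ge 0}$ be two sequences of positive real numbers, with $P_m=p_0+p_1+\dots+p_m\to\infty$ as $m\to\infty$. (i) If $\left(\frac{1}{u_m}\right)\in\ell_\infty$, then $|f(\overline{N}_p^u)|_k\subset \ell_\infty$ for $k\ge 1$. (ii) If $k>1$ and $$\sum_{m=0}^{\infty}u_m^{k-1}\left(\frac{p_m}{P_m}\right)^k<\infty,$$ then $bs\subset |f(\overline{N}_p^u)|_k$.
   Context: All sequences are sequences of complex numbers indexed by $0,1,2,\dots$ unless stated otherwise; a series $\sum a_v$ is identified with its sequence of terms $a=(a_v)$. Let $(p_n)$ be a sequence of positive real numbers with $P_n=p_0+\dots+p_n\to\infty$, and $(u_n)$ a sequence of positive real numbers. For a sequence $a=(a_v)_{v\ge 0}$ and $m,n\ge 0$ put $$F_{m,n}(a)=\begin{cases} a_n, & m=0,\\[2pt] \dfrac{p_m}{P_mP_{m-1}}\displaystyle\sum_{v=1}^{m}P_{v-1}a_{n+v}, & m\ge 1.\end{cases}$$ For $k\ge 1$, $|f(\overline{N}_p^u)|_k$ is the set of all complex sequences $a$ such that the series $\sum_{m=0}^{\infty}u_m^{k-1}|F_{m,n}(a)|^k$ converges uniformly in $n\ge 0$ (i.e. it converges for every $n$ and its tails $\sum_{m\ge M}u_m^{k-1}|F_{m,n}(a)|^k$ tend to $0$ as $M\to\infty$ uniformly in $n$). $\ell_\infty$ is the set of all bounded complex sequences, and $bs$ is the set of all bounded series, i.e. sequences $a$ with $\sup_v\left|\sum_{j=0}^{v}a_j\right|<\infty$.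 *)

theory Defs
  imports "HOL-Analysis.Analysis"
begin

text \<open>A series is identified with its sequence of terms.\<close>

definition psum :: "(nat \<Rightarrow> real) \<Rightarrow> nat \<Rightarrow> real"
  where "psum p n = (\<Sum>i\<le>n. p i)"

definition F :: "(nat \<Rightarrow> real) \<Rightarrow> nat \<Rightarrow> nat \<Rightarrow> (nat \<Rightarrow> complex) \<Rightarrow> complex"
  where "F p m n a =
    (if m = 0 then a n
     else of_real (p m / (psum p m * psum p (m - 1))) *
          (\<Sum>v=1..m. of_real (psum p (v - 1)) * a (n + v)))"

text \<open>The space \<open>|f(N_p^u)|_k\<close>. The exponent \<open>k\<close> is real. Uniform convergence of the
  series over \<open>m\<close> is uniform convergence of its partial sums, as functions of \<open>n\<close>.\<close>

definition abs_f_Nbar :: "(nat \<Rightarrow> real) \<Rightarrow> (nat \<Rightarrow> real) \<Rightarrow> real \<Rightarrow> (nat \<Rightarrow> complex) set"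
  where "abs_f_Nbar p u k =
    {a. uniformly_convergent_on UNIV
          (\<lambda>M n. \<Sum>m<M. u m powr (k - 1) * norm (F p m n a) powr k)}"

definition ell_infinity :: "(nat \<Rightarrow> complex) set"
  where "ell_infinity = {a. bounded (range a)}"

definition bs :: "(nat \<Rightarrow> complex) set"
  where "bs = {a. bounded (range (\<lambda>v. \<Sum>j\<le>v. a j))}"

end

theory Submission
  imports Defs
begin

text \<open>For (i), uniform convergence makes \<open>F p m n a\<close> bounded in \<open>n\<close> for each single large \<open>m\<close>;
  the numerators of the means for two consecutive values of \<open>m\<close> differ by
  \<open>P\<^sub>m a\<^sub>n\<^sub>+\<^sub>m\<^sub>+\<^sub>1\<close>, so \<open>a\<close> is bounded.
  For (ii), summation by parts bounds \<open>\<bar>F p m n a\<bar>\<close> by \<open>2 B p\<^sub>m / P\<^sub>m\<close> uniformly in \<open>n\<close>, where \<open>B\<close>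
  bounds the partial sums of \<open>a\<close>, and the Weierstrass M-test applies.\<close>

lemma psum_Suc: "psum p (Suc n) = psum p n + p (Suc n)"
  by (simp add: psum_def)

lemma psum_pos:
  assumes "\<And>m. p m > 0"
  shows "psum p n > 0"
  unfolding psum_def by (rule sum_pos) (use assms in auto)

lemma bounded_range_shift:
  fixes f :: "nat \<Rightarrow> 'a::real_normed_vector"
  assumes "bounded (range (\<lambda>n. f (n + m)))"
  shows "bounded (range f)"
proof -
  have "f n \<in> f ` {..<m} \<union> range (\<lambda>n. f (n + m))" for n
  proof (cases "n < m")
    case False
    then have "f n = f ((n - m) + m)" by simp
    then show ?thesis by blast
  qed simp
  then have "range f \<subseteq> f ` {..<m} \<union> range (\<lambda>n. f (n + m))" by blast
  moreover have "bounded (f ` {..<m} \<union> range (\<lambda>n. f (n + m)))"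
    using assms by (simp add: finite_imp_bounded)
  ultimately show ?thesis by (rule bounded_subset[rotated])
qed

text \<open>Each term is the difference of two consecutive partial sums, so the uniform Cauchy
  criterion, available because the codomain is complete, makes it small uniformly in
  \<open>x\<close>.\<close>

lemma uniformly_convergent_on_terms_bounded:
  fixes f :: "nat \<Rightarrow> 'a \<Rightarrow> 'b::banach"
  assumes "uniformly_convergent_on X (\<lambda>M x. \<Sum>m<M. f m x)" and "e > 0"
  obtains M where "\<And>m x. m \<ge> M \<Longrightarrow> x \<in> X \<Longrightarrow> norm (f m x) < e"
proof -
  have "uniformly_Cauchy_on X (\<lambda>M x. \<Sum>m<M. f m x)"
    using assms(1) by (simp add: uniformly_convergent_eq_Cauchy)
  then obtain M where M: "\<And>x m n. x \<in> X \<Longrightarrow> m \<ge> M \<Longrightarrow> n \<ge> M \<Longrightarrow>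
      dist (\<Sum>i<m. f i x) (\<Sum>i<n. f i x) < e"
    using assms(2) unfolding uniformly_Cauchy_on_def by blast
  show thesis
  proof (rule that)
    fix m x assume "m \<ge> M" "x \<in> X"
    then show "norm (f m x) < e"
      using M[of x "Suc m" m] by (simp add: dist_norm)
  qed
qed

text \<open>Abel summation: each term of \<open>a\<close> is a difference of consecutive partial
  sums, and the weights satisfy P_v - P_(v-1) = p_v. The first weight P_0 = p_0 supplies the summand
  \<open>v = 0\<close> on the right.\<close>

lemma weighted_sum_by_parts:
  fixes a :: "nat \<Rightarrow> complex"
  shows "(\<Sum>v=1..Suc m. of_real (psum p (v - 1)) * a (n + v)) =
    of_real (psum p m) * (\<Sum>j\<le>n + Suc m. a j) - (\<Sum>v\<le>m. of_real (p v) * (\<Sum>j\<le>n + v. a j))"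
proof (induction m)
  case 0
  show ?case by (simp add: psum_def algebra_simps)
next
  case (Suc m)
  have "(\<Sum>v=1..Suc (Suc m). of_real (psum p (v - 1)) * a (n + v)) =
      (\<Sum>v=1..Suc m. of_real (psum p (v - 1)) * a (n + v))
        + of_real (psum p (Suc m)) * a (n + Suc (Suc m))"
    by (subst sum.nat_ivl_Suc') auto
  then show ?case
    unfolding Suc.IH by (simp add: psum_Suc algebra_simps)
qed

lemma norm_F_le:
  assumes p: "\<And>m. p m > 0" and B: "\<And>v. norm (\<Sum>j\<le>v. a j) \<le> B"
  shows "norm (F p m n a) \<le> 2 * B * (p m / psum p m)"
proof (cases m)
  case 0
  have "B \<ge> 0" using B[of 0] norm_ge_zero order_trans by blast
  \<comment> \<open>Since p_0 / P_0 = 1, this is the whole claim for \<open>m = 0\<close>; the case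
    \<open>n = 0\<close> is separate because no partial sum precedes the first.\<close>
  have "norm (a n) \<le> 2 * B"
  proof (cases n)
    case 0
    with B[of 0] \<open>B \<ge> 0\<close> show ?thesis by simp
  next
    case (Suc i)
    have "a n = (\<Sum>j\<le>Suc i. a j) - (\<Sum>j\<le>i. a j)" by (simp add: Suc)
    then show ?thesis
      using norm_triangle_ineq4[of "\<Sum>j\<le>Suc i. a j" "\<Sum>j\<le>i. a j"] B[of i] B[of "Suc i"] by simp
  qed
  moreover have "p 0 \<noteq> 0" using p[of 0] by simp
  ultimately show ?thesis by (simp add: 0 F_def psum_def)
next
  case (Suc i)
  define T where "T = (\<Sum>v=1..Suc i. of_real (psum p (v - 1)) * a (n + v))"
  have P: "psum p i > 0" "psum p (Suc i) > 0" using p by (simp_all add: psum_pos)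
  \<comment> \<open>The positive weights p_0, ..., p_i add up to P_i, so this sum obeys the same
    bound as the boundary term. Together they give the factor 2, and P_i later cancels against the
    denominator of \<open>F\<close>.\<close>
  have "norm (\<Sum>v\<le>i. of_real (p v) * (\<Sum>j\<le>n + v. a j)) \<le> (\<Sum>v\<le>i. p v * B)"
    by (rule sum_norm_le) (use p B in \<open>simp add: norm_mult less_imp_le\<close>)
  also have "\<dots> = psum p i * B" by (simp add: psum_def sum_distrib_right)
  finally have "norm (\<Sum>v\<le>i. of_real (p v) * (\<Sum>j\<le>n + v. a j)) \<le> psum p i * B" .
  moreover have "norm (of_real (psum p i) * (\<Sum>j\<le>n + Suc i. a j)) \<le> psum p i * B"
    using P B[of "n + Suc i"] by (simp add: norm_mult)
  ultimately have T: "norm T \<le> 2 * B * psum p i"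
    unfolding T_def weighted_sum_by_parts
    by (intro order_trans[OF norm_triangle_ineq4]) (simp add: algebra_simps)
  have "norm (F p m n a) = p m / (psum p m * psum p i) * norm T"
    using p[of m] P by (simp add: F_def Suc T_def norm_mult norm_divide)
  also have "\<dots> \<le> p m / (psum p m * psum p i) * (2 * B * psum p i)"
    by (rule mult_left_mono[OF T]) (use p[of m] P in \<open>simp add: Suc\<close>)
  also have "\<dots> = 2 * B * (p m / psum p m)"
    using P by (simp add: field_simps)
  finally show ?thesis .
qed

lemma abs_f_Nbar_subset_ell_infinity:
  assumes p: "\<And>m. p m > 0" and u: "\<And>m. u m > 0" and k: "k > 0"
  shows "abs_f_Nbar p u k \<subseteq> ell_infinity"
proof
  fix a assume "a \<in> abs_f_Nbar p u k"
  then have "uniformly_convergent_on UNIV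
      (\<lambda>M n. \<Sum>m<M. u m powr (k - 1) * norm (F p m n a) powr k)"
    by (simp add: abs_f_Nbar_def)
  then obtain M where M: "\<And>m n. m \<ge> M \<Longrightarrow>
      norm (u m powr (k - 1) * norm (F p m n a) powr k) < 1"
    by (rule uniformly_convergent_on_terms_bounded[where e = 1]) auto
  define T where "T m n = (\<Sum>v=1..m. of_real (psum p (v - 1)) * a (n + v))" for m n
  have T_bounded: "bounded (range (T (Suc m)))" if "Suc m \<ge> M" for m
  proof -
    define c where "c = p (Suc m) / (psum p (Suc m) * psum p m)"
    have c: "c > 0" using p by (simp add: c_def psum_pos)
    \<comment> \<open>The k-th root of the bound that a term below 1 imposes on the k-th power of
      \<open>norm (F p (Suc m) n a)\<close>. Both \<open>c\<close> and \<open>D\<close> may depend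
      on \<open>m\<close>; only independence of \<open>n\<close> matters.\<close>
    define D where "D = (1 / u (Suc m) powr (k - 1)) powr (1 / k)"
    have "norm (T (Suc m) n) \<le> D / c" for n
    proof -
      have "u (Suc m) powr (k - 1) > 0" using u[of "Suc m"] by simp
      then have "norm (F p (Suc m) n a) powr k \<le> 1 / u (Suc m) powr (k - 1)"
        using M[OF that, of n] by (simp add: field_simps)
      then have "(norm (F p (Suc m) n a) powr k) powr (1 / k) \<le> D"
        unfolding D_def by (intro powr_mono2) (use k in auto)
      then have "norm (F p (Suc m) n a) \<le> D"
        using k by (simp add: powr_powr)
      moreover have "F p (Suc m) n a = of_real c * T (Suc m) n"
        by (simp add: F_def T_def c_def)
      ultimately show ?thesis
        using c by (simp add: norm_mult field_simps)
    qed
    then show ?thesis by (auto intro: boundedI)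
  qed
  \<comment> \<open>With this choice \<open>m\<close> and \<open>Suc m\<close> are both successors
    that are at least \<open>M\<close>, so \<open>T_bounded\<close> covers both sums.\<close>
  define m where "m = Suc M"
  have P: "psum p m > 0" using p by (rule psum_pos)
  have "a (n + Suc m) = (T (Suc m) n - T m n) / of_real (psum p m)" for n
    using P by (simp add: T_def)
  moreover obtain C where "\<And>n. norm (T m n) \<le> C"
    using T_bounded[of M] by (auto simp: m_def bounded_iff)
  moreover obtain D where "\<And>n. norm (T (Suc m) n) \<le> D"
    using T_bounded[of m] by (auto simp: m_def bounded_iff)
  ultimately have "norm (a (n + Suc m)) \<le> (D + C) / psum p m" for n
    using P by (auto simp add: norm_divide simp del: add_Suc_right
      intro!: divide_right_mono order_trans[OF norm_triangle_ineq4 add_mono])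
  \<comment> \<open>As \<open>m\<close> is fixed, the shift omits only finitely many terms of
    \<open>a\<close>.\<close>
  then have "bounded (range (\<lambda>n. a (n + Suc m)))" by (auto intro: boundedI)
  then show "a \<in> ell_infinity"
    unfolding ell_infinity_def by (blast intro: bounded_range_shift)
qed

lemma bs_subset_abs_f_Nbar:
  assumes p: "\<And>m. p m > 0" and k: "k > 0"
    and summable: "summable (\<lambda>m. u m powr (k - 1) * (p m / psum p m) powr k)"
  shows "bs \<subseteq> abs_f_Nbar p u k"
proof
  fix a assume "a \<in> bs"
  then obtain B where B: "\<And>v. norm (\<Sum>j\<le>v. a j) \<le> B"
    by (auto simp: bs_def bounded_iff)
  \<comment> \<open>The majorant is free of \<open>n\<close>: the bound 2 B p_m / P_m is raised to
    the power \<open>k\<close> and the constant pulled out, leaving the series assumed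
    summable.\<close>
  define g where "g m = (2 * B) powr k * (u m powr (k - 1) * (p m / psum p m) powr k)" for m
  have "norm (u m powr (k - 1) * norm (F p m n a) powr k) \<le> g m" for m n
  proof -
    have "norm (F p m n a) powr k \<le> (2 * B * (p m / psum p m)) powr k"
      using k by (intro powr_mono2 norm_F_le[OF p B]) auto
    also have "\<dots> = (2 * B) powr k * (p m / psum p m) powr k"
      by (rule powr_mult)
    finally have "u m powr (k - 1) * norm (F p m n a) powr k
        \<le> u m powr (k - 1) * ((2 * B) powr k * (p m / psum p m) powr k)"
      by (rule mult_left_mono) simp
    then show ?thesis by (simp add: g_def mult_ac)
  qed
  moreover have "summable g"
    unfolding g_def by (rule summable_mult[OF summable])
  ultimately have "uniformly_convergent_on UNIV
      (\<lambda>M n. \<Sum>m<M. u m powr (k - 1) * norm (F p m n a) powr k)"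
    by (intro Weierstrass_m_test'[where M = g]) auto
  then show "a \<in> abs_f_Nbar p u k" by (simp add: abs_f_Nbar_def)
qed

theorem theorem2p2:
  fixes p u :: "nat \<Rightarrow> real"
  assumes p_pos: "\<And>m. p m > 0"
    and u_pos: "\<And>m. u m > 0"
    and P_lim: "filterlim (psum p) at_top sequentially"
  shows "((\<lambda>m. complex_of_real (1 / u m)) \<in> ell_infinity \<longrightarrow>
            (\<forall>k\<ge>1. abs_f_Nbar p u k \<subseteq> ell_infinity)) \<and>
         (\<forall>k>1. summable (\<lambda>m. u m powr (k - 1) * (p m / psum p m) powr k) \<longrightarrow>
            bs \<subseteq> abs_f_Nbar p u k)"
proof (intro conjI impI allI)
  fix k :: real assume "k \<ge> 1"
  then show "abs_f_Nbar p u k \<subseteq> ell_infinity"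
    by (intro abs_f_Nbar_subset_ell_infinity p_pos u_pos) simp
next
  fix k :: real
  assume "k > 1" and "summable (\<lambda>m. u m powr (k - 1) * (p m / psum p m) powr k)"
  then show "bs \<subseteq> abs_f_Nbar p u k"
    by (intro bs_subset_abs_f_Nbar p_pos) auto
qed

end
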